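(* Let $f(d,n)$ denote the maximal number of points that can be encapsulated by $n$ convex sets in $\mathbb{R}^d$. For all integers $n > 3$ and $d \ge 2$, $$f(d,n) \le \sum_{i=2}^{n-1} \binom{n}{i} f(d,i) + f(d-2,n),$$ and consequently $$f(d,n) \le 2 d^{n-2} n!.$$
   Context: A point $p \in \mathbb{R}^d$ is encapsulated by the convex sets $K_1, \ldots, K_n \subset \mathbb{R}^d$ if for some $\epsilon > 0$, $B(p,\epsilon) \setminus (\bigcup_{i=1}^n K_i) = \{p\}$, where $B(p,\epsilon)$ is the open ball of radius $\epsilon$ centered at $p$. For integers $d \ge 0$, $n \ge 1$, $f(d,n)$ is the maximum, over all choices of $n$ convex sets $K_1,\ldots,K_n \subset \mathbb{R}^d$, of the number of points $p\in\mathbb{R}^d$ encapsulated by $K_1,\ldots,K_n$. The sets $K_i$ are arbitrary convex sets (not assumed open, closed, bounded or nonempty). $\mathbb{R}^0$ is a single point. *)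

theory Defs
  imports
    "HOL-Analysis.Analysis"
    "HOL-Library.Function_Algebras"
    "HOL-Library.Extended_Nat"
begin

text \<open>
  The dimension varies inside the statement and may be 0, so \<open>\<real>\<^sup>d\<close> is the library's carrier
  \<open>topspace (Euclidean_space d) = {x. \<forall>i\<ge>d. x i = 0}\<close> of functions \<open>nat \<Rightarrow> real\<close>, not a type. The
  pointwise vector space structure below makes the library's \<^const>\<open>convex\<close> available on it.
\<close>

instantiation "fun" :: (type, real_vector) real_vector
begin

definition scaleR_fun :: "real \<Rightarrow> ('a \<Rightarrow> 'b) \<Rightarrow> 'a \<Rightarrow> 'b"
  where "scaleR_fun c f = (\<lambda>x. c *\<^sub>R f x)"

instance
  by standard (simp_all add: scaleR_fun_def fun_eq_iff scaleR_add_right scaleR_add_left)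

end

abbreviation Rn :: "nat \<Rightarrow> (nat \<Rightarrow> real) set"
  where "Rn d \<equiv> topspace (Euclidean_space d)"

text \<open>
  The library's \<^const>\<open>dist\<close> and \<^const>\<open>ball\<close> on \<open>nat \<Rightarrow> real\<close> come from a metric for the
  product topology that is not the Euclidean one.
\<close>

definition euclid_ball :: "nat \<Rightarrow> (nat \<Rightarrow> real) \<Rightarrow> real \<Rightarrow> (nat \<Rightarrow> real) set"
  where "euclid_ball d p \<epsilon> = {x \<in> Rn d. sqrt (\<Sum>i<d. (x i - p i)\<^sup>2) < \<epsilon>}"

definition encapsulated ::
    "nat \<Rightarrow> nat \<Rightarrow> (nat \<Rightarrow> (nat \<Rightarrow> real) set) \<Rightarrow> (nat \<Rightarrow> real) \<Rightarrow> bool"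
  where "encapsulated d n K p \<longleftrightarrow>
    p \<in> Rn d \<and> (\<exists>\<epsilon>>0. euclid_ball d p \<epsilon> - (\<Union>i\<in>{1..n}. K i) = {p})"

definition convex_family :: "nat \<Rightarrow> nat \<Rightarrow> (nat \<Rightarrow> (nat \<Rightarrow> real) set) \<Rightarrow> bool"
  where "convex_family d n K \<longleftrightarrow> (\<forall>i\<in>{1..n}. K i \<subseteq> Rn d \<and> convex (K i))"

definition ecard :: "'a set \<Rightarrow> enat"
  where "ecard A = (if finite A then enat (card A) else \<infinity>)"

text \<open>
  The supremum is taken in \<^typ>\<open>enat\<close>, so that an upper bound on \<open>max_encapsulated d n\<close> really bounds every
  configuration and nothing about finiteness is presupposed. Whenever \<open>max_encapsulated d n\<close> is finite it is
  a maximum, see \<open>max_encapsulated_attained\<close>.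
\<close>

definition max_encapsulated :: "nat \<Rightarrow> nat \<Rightarrow> enat"
  where "max_encapsulated d n = (SUP K\<in>{K. convex_family d n K}. ecard {p. encapsulated d n K p})"

lemma max_encapsulated_attained:
  assumes "max_encapsulated d n \<noteq> \<infinity>"
  shows "\<exists>K. convex_family d n K \<and> ecard {p. encapsulated d n K p} = max_encapsulated d n"
proof -
  let ?S = "(\<lambda>K. ecard {p. encapsulated d n K p}) ` {K. convex_family d n K}"
  have "convex_family d n (\<lambda>_. {})"
    by (simp add: convex_family_def)
  then have ne: "?S \<noteq> {}"
    by blast
  have "Sup ?S \<noteq> \<infinity>"
    using assms by (simp add: max_encapsulated_def)
  then have "finite ?S"
    using ne by (auto simp: Sup_enat_def split: if_splits)
  then have "Sup ?S \<in> ?S"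
    using ne Max_in by (simp add: Sup_enat_def)
  then show ?thesis
    by (auto simp: max_encapsulated_def)
qed

end

theory Submission
  imports Defs
begin

text \<open>
  Apart from the points that \<open>n - 1\<close> of the sets already encapsulate, at most \<open>n f(d, n - 1)\<close> of them,
  only the set \<open>E\<close> of points that need all \<open>n\<close> sets is left. Every \<open>K\<^sub>i\<close> has all of \<open>E\<close> in its closure.
  If \<open>a\<close> is encapsulated and \<open>S\<close> lies in the closure of every \<open>K\<^sub>i\<close>, then \<open>S - a\<close> cannot span \<open>\<real>\<^sup>d\<close>: a
  point near \<open>a\<close> and opposite to the simplex of a basis in \<open>S - a\<close> lies in some \<open>K\<^sub>i\<close>, which would then
  contain \<open>a\<close>. Hence \<open>E\<close> lies in a hyperplane, and restricting the sets to a flat keeps the points in it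
  encapsulated, so \<open>f(d, n) \<le> n f(d, n - 1) + f(d - 1, n)\<close>. The set \<open>E\<close> need not lie in a flat of
  codimension 2, but if it spans a hyperplane, then by the same argument every encapsulated point is in
  this hyperplane, and \<open>f(d, n) \<le> f(d - 1, n) \<le> n f(d - 1, n - 1) + f(d - 2, n)\<close>. As \<open>f\<close> increases
  with the dimension, \<open>f(d, n) \<le> n f(d, n - 1) + f(d - 2, n)\<close> in all cases, and \<open>n f(d, n - 1)\<close> is the
  term \<open>i = n - 1\<close> of the sum.
\<close>

section \<open>Encapsulation and closure in the maximum norm\<close>

text \<open>A single set \<open>L\<close> replaces the indexed family, so that unions over any index
  set fit. Cubes replace Euclidean balls, so that later estimates go coordinate by
  coordinate.\<close>

definition punctured_nhd :: "nat \<Rightarrow> (nat \<Rightarrow> real) set \<Rightarrow> (nat \<Rightarrow> real) \<Rightarrow> bool"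
  where "punctured_nhd d L p \<longleftrightarrow> p \<in> Rn d \<and> p \<notin> L \<and>
    (\<exists>\<delta>>0. \<forall>x\<in>Rn d. x \<noteq> p \<longrightarrow> (\<forall>i<d. \<bar>x i - p i\<bar> < \<delta>) \<longrightarrow> x \<in> L)"

text \<open>For \<open>X \<subseteq> Rn d\<close> and \<open>p \<in> Rn d\<close> this is membership
  in the closure of \<open>X\<close>, as all coordinates from \<open>d\<close> on vanish
  there.\<close>

definition adherent :: "nat \<Rightarrow> (nat \<Rightarrow> real) set \<Rightarrow> (nat \<Rightarrow> real) \<Rightarrow> bool"
  where "adherent d X p \<longleftrightarrow> (\<forall>\<delta>>0. \<exists>x\<in>X. \<forall>i<d. \<bar>x i - p i\<bar> < \<delta>)"

lemma Rn_iff: "x \<in> Rn d \<longleftrightarrow> (\<forall>i\<ge>d. x i = 0)"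
  by (simp add: topspace_Euclidean_space)

lemma scaleR_fun_apply [simp]: "(c *\<^sub>R f) x = c *\<^sub>R f x"
  by (simp add: scaleR_fun_def)

lemma sum_fun_apply: "(\<Sum>k\<in>T. f k) x = (\<Sum>k\<in>T. f k x)"
  by (induction T rule: infinite_finite_induct) auto

lemma subspace_Rn: "subspace (Rn d)"
  by (auto simp: subspace_def Rn_iff)

text \<open>The Euclidean norm lies between the maximum norm and the sum of the absolute
  coordinates, so each ball around \<open>p\<close> contains a cube and vice versa.\<close>

lemma encapsulated_iff: "encapsulated d n K p \<longleftrightarrow> punctured_nhd d (\<Union>i\<in>{1..n}. K i) p"
proof
  assume "encapsulated d n K p"
  then obtain \<epsilon> where p: "p \<in> Rn d" and "\<epsilon> > 0"
    and e: "euclid_ball d p \<epsilon> - (\<Union>i\<in>{1..n}. K i) = {p}"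
    by (auto simp: encapsulated_def)
  \<comment> \<open>Dividing by \<open>d + 1\<close> instead of \<open>d\<close> covers dimension 0
    and makes the estimate strict.\<close>
  have "x \<in> (\<Union>i\<in>{1..n}. K i)"
    if x: "x \<in> Rn d" "x \<noteq> p" "\<forall>i<d. \<bar>x i - p i\<bar> < \<epsilon> / (real d + 1)" for x
  proof -
    have "sqrt (\<Sum>i<d. (x i - p i)\<^sup>2) \<le> (\<Sum>i<d. \<bar>x i - p i\<bar>)"
      using L2_set_le_sum_abs[of "\<lambda>i. x i - p i" "{..<d}"] by (simp add: L2_set_def)
    also have "\<dots> \<le> (\<Sum>i<d. \<epsilon> / (real d + 1))"
      using x(3) by (intro sum_mono) (simp add: less_imp_le)
    also have "\<dots> < \<epsilon>"
      using \<open>\<epsilon> > 0\<close> by (simp add: field_simps)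
    finally have "x \<in> euclid_ball d p \<epsilon>"
      using x(1) by (simp add: euclid_ball_def)
    with x(2) e show ?thesis by blast
  qed
  moreover have "\<epsilon> / (real d + 1) > 0"
    using \<open>\<epsilon> > 0\<close> by simp
  moreover have "p \<notin> (\<Union>i\<in>{1..n}. K i)"
    using e by blast
  ultimately show "punctured_nhd d (\<Union>i\<in>{1..n}. K i) p"
    unfolding punctured_nhd_def using p by blast
next
  assume "punctured_nhd d (\<Union>i\<in>{1..n}. K i) p"
  then obtain \<delta> where p: "p \<in> Rn d" "p \<notin> (\<Union>i\<in>{1..n}. K i)" and "\<delta> > 0"
    and \<delta>: "\<forall>x\<in>Rn d. x \<noteq> p \<longrightarrow> (\<forall>i<d. \<bar>x i - p i\<bar> < \<delta>) \<longrightarrow> x \<in> (\<Union>i\<in>{1..n}. K i)"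
    unfolding punctured_nhd_def by blast
  have "x \<in> (\<Union>i\<in>{1..n}. K i)" if x: "x \<in> euclid_ball d p \<delta>" "x \<noteq> p" for x
  proof (rule \<delta>[rule_format])
    show "x \<in> Rn d" "x \<noteq> p"
      using x by (auto simp: euclid_ball_def)
    fix i assume "i < d"
    then have "(x i - p i)\<^sup>2 \<le> (\<Sum>i<d. (x i - p i)\<^sup>2)"
      by (intro member_le_sum) auto
    then have "\<bar>x i - p i\<bar> \<le> sqrt (\<Sum>i<d. (x i - p i)\<^sup>2)"
      by (simp add: real_le_rsqrt)
    also have "\<dots> < \<delta>"
      using x by (simp add: euclid_ball_def)
    finally show "\<bar>x i - p i\<bar> < \<delta>" .
  qed
  moreover have "p \<in> euclid_ball d p \<delta>"
    using p \<open>\<delta> > 0\<close> by (simp add: euclid_ball_def)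
  ultimately have "euclid_ball d p \<delta> - (\<Union>i\<in>{1..n}. K i) = {p}"
    using p by blast
  then show "encapsulated d n K p"
    unfolding encapsulated_def using p \<open>\<delta> > 0\<close> by blast
qed

subsection \<open>Linear algebra in the coordinate space\<close>

lemma Rn_basis_expansion:
  assumes "x \<in> Rn d"
  shows "x = (\<Sum>i<d. x i *\<^sub>R (\<lambda>j. of_bool (j = i)))"
proof
  fix j
  have "(\<Sum>i<d. x i *\<^sub>R (\<lambda>j. of_bool (j = i))) j = (\<Sum>i<d. if i = j then x i else 0)"
    unfolding sum_fun_apply by (intro sum.cong) auto
  also have "\<dots> = x j"
    using assms by (auto simp: Rn_iff)
  finally show "x j = (\<Sum>i<d. x i *\<^sub>R (\<lambda>j. of_bool (j = i))) j" by simp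
qed

lemma Rn_subset_span: "Rn d \<subseteq> span ((\<lambda>i j. of_bool (j = i)) ` {..<d})"
proof
  fix x assume "x \<in> Rn d"
  show "x \<in> span ((\<lambda>i j. of_bool (j = i)) ` {..<d})"
    by (subst Rn_basis_expansion[OF \<open>x \<in> Rn d\<close>]) (intro span_sum span_scale span_base, auto)
qed

text \<open>The ambient type is infinite-dimensional, so the dimension of \<open>Rn d\<close> enters
  through the exchange lemma applied to the \<open>d\<close> unit vectors.\<close>

lemma independent_Rn:
  assumes "independent B" "B \<subseteq> Rn d"
  shows "finite B" "card B \<le> d"
proof -
  have "B \<subseteq> span ((\<lambda>i j. of_bool (j = i)) ` {..<d})"
    using assms(2) Rn_subset_span by (rule subset_trans)
  with assms(1) have "finite B \<and> card B \<le> card ((\<lambda>i (j::nat). of_bool (j = i) :: real) ` {..<d})"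
    by (intro independent_span_bound) auto
  moreover have "card ((\<lambda>i (j::nat). of_bool (j = i) :: real) ` {..<d}) \<le> d"
    using card_image_le[of "{..<d}"] by simp
  ultimately show "finite B" "card B \<le> d" by auto
qed

text \<open>A vector outside the span would extend \<open>B\<close> to \<open>d + 1\<close>
  independent vectors.\<close>

lemma independent_card_spans_Rn:
  assumes "independent B" "B \<subseteq> Rn d" "card B = d"
  shows "Rn d \<subseteq> span B"
proof
  fix x assume x: "x \<in> Rn d"
  show "x \<in> span B"
  proof (rule ccontr)
    assume n: "x \<notin> span B"
    then have "independent (insert x B)"
      using assms(1) independent_insertI by blast
    then have "card (insert x B) \<le> d"
      using independent_Rn assms(2) x by blast
    moreover have "x \<notin> B"
      using n span_base by blast
    ultimately show False
      using assms independent_Rn[OF assms(1,2)] by simp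
  qed
qed

subsection \<open>Perturbing positive representations\<close>

text \<open>For vectors \<open>u k\<close> in \<open>Rn d\<close> the two conditions put
  \<open>b\<close> in the interior of the cone that they generate. An indexed family allows one
  vector to be moved while the others stay.\<close>

definition pos_rep :: "nat \<Rightarrow> 'k set \<Rightarrow> ('k \<Rightarrow> nat \<Rightarrow> real) \<Rightarrow> (nat \<Rightarrow> real) \<Rightarrow> bool"
  where "pos_rep d T u b \<longleftrightarrow> (\<forall>x\<in>Rn d. \<exists>\<alpha>. x = (\<Sum>k\<in>T. \<alpha> k *\<^sub>R u k)) \<and>
    (\<exists>c. (\<forall>k\<in>T. c k > 0) \<and> b = (\<Sum>k\<in>T. c k *\<^sub>R u k))"

text \<open>Fixed expansions of the unit vectors give coefficients of \<open>e\<close> that are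
  linear in the coordinates of \<open>e\<close>, hence small when these are.\<close>

lemma small_coefficients:
  fixes u :: "'k \<Rightarrow> nat \<Rightarrow> real"
  assumes T: "finite T" and sp: "\<forall>x\<in>Rn d. \<exists>\<alpha>. x = (\<Sum>k\<in>T. \<alpha> k *\<^sub>R u k)" and "\<eta> > 0"
  shows "\<exists>\<delta>>0. \<forall>e\<in>Rn d. (\<forall>i<d. \<bar>e i\<bar> < \<delta>) \<longrightarrow>
      (\<exists>\<alpha>. e = (\<Sum>k\<in>T. \<alpha> k *\<^sub>R u k) \<and> (\<forall>k\<in>T. \<bar>\<alpha> k\<bar> < \<eta>))"
proof -
  have "\<forall>i. \<exists>\<alpha>. i < d \<longrightarrow> (\<lambda>j. of_bool (j = i)) = (\<Sum>k\<in>T. \<alpha> k *\<^sub>R u k)"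
    using sp by (auto simp: Rn_iff)
  then obtain M where M: "\<And>i. i < d \<Longrightarrow> (\<lambda>j. of_bool (j = i)) = (\<Sum>k\<in>T. M i k *\<^sub>R u k)"
    by metis
  \<comment> \<open>\<open>C\<close> dominates the sum of \<open>\<bar>M i k\<bar>\<close> over all
    \<open>i\<close> and \<open>k\<close>, so it will do for each coefficient; the
    \<open>+ 1\<close> below avoids division by 0 and gives strictness.\<close>
  define C where "C = (\<Sum>i<d. \<Sum>k\<in>T. \<bar>M i k\<bar>)"
  have C: "C \<ge> 0"
    unfolding C_def by (intro sum_nonneg) auto
  show ?thesis
  proof (intro exI[of _ "\<eta> / (C + 1)"] conjI ballI impI)
    show "\<eta> / (C + 1) > 0"
      using C \<open>\<eta> > 0\<close> by simp
    fix e :: "nat \<Rightarrow> real"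
    assume e: "e \<in> Rn d" "\<forall>i<d. \<bar>e i\<bar> < \<eta> / (C + 1)"
    have "e = (\<Sum>i<d. e i *\<^sub>R (\<Sum>k\<in>T. M i k *\<^sub>R u k))"
      by (subst Rn_basis_expansion[OF e(1)]) (intro sum.cong refl, simp add: M)
    also have "\<dots> = (\<Sum>k\<in>T. \<Sum>i<d. (e i * M i k) *\<^sub>R u k)"
      unfolding scaleR_sum_right scaleR_scaleR by (rule sum.swap)
    also have "\<dots> = (\<Sum>k\<in>T. (\<Sum>i<d. e i * M i k) *\<^sub>R u k)"
      by (simp add: scaleR_sum_left)
    finally have "e = (\<Sum>k\<in>T. (\<Sum>i<d. e i * M i k) *\<^sub>R u k)" .
    moreover have "\<bar>\<Sum>i<d. e i * M i k\<bar> < \<eta>" if "k \<in> T" for k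
    proof -
      have "\<bar>\<Sum>i<d. e i * M i k\<bar> \<le> (\<Sum>i<d. \<bar>e i\<bar> * \<bar>M i k\<bar>)"
        using sum_abs[of "\<lambda>i. e i * M i k" "{..<d}"] by (simp add: abs_mult)
      also have "\<dots> \<le> (\<Sum>i<d. \<eta> / (C + 1) * (\<Sum>k\<in>T. \<bar>M i k\<bar>))"
        using e(2) T that C \<open>\<eta> > 0\<close>
        by (intro sum_mono mult_mono member_le_sum) (auto intro: less_imp_le)
      also have "\<dots> = \<eta> / (C + 1) * C"
        by (simp add: C_def sum_distrib_left)
      also have "\<dots> < \<eta>"
        using C \<open>\<eta> > 0\<close> by (simp add: field_simps)
      finally show ?thesis .
    qed
    ultimately show "\<exists>\<alpha>. e = (\<Sum>k\<in>T. \<alpha> k *\<^sub>R u k) \<and> (\<forall>k\<in>T. \<bar>\<alpha> k\<bar> < \<eta>)"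
      by (intro exI[of _ "\<lambda>k. \<Sum>i<d. e i * M i k"] conjI ballI)
  qed
qed

text \<open>If \<open>w - u l\<close> has small coefficients in the \<open>u k\<close>, the relation
  can be solved for \<open>u l\<close>. Rewriting any combination with \<open>w\<close> in place of
  \<open>u l\<close> then changes the coefficients only slightly.\<close>

lemma pos_rep_perturb:
  assumes T: "finite T" "l \<in> T" and pr: "pos_rep d T u b" and ul: "u l \<in> Rn d"
  shows "\<exists>\<delta>>0. \<forall>w\<in>Rn d. (\<forall>i<d. \<bar>w i - u l i\<bar> < \<delta>) \<longrightarrow> pos_rep d T (u(l := w)) b"
proof -
  from pr obtain c where sp: "\<forall>x\<in>Rn d. \<exists>\<alpha>. x = (\<Sum>k\<in>T. \<alpha> k *\<^sub>R u k)"
    and c: "\<And>k. k \<in> T \<Longrightarrow> c k > 0" and b: "b = (\<Sum>k\<in>T. c k *\<^sub>R u k)"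
    unfolding pos_rep_def by blast
  define m where "m = Min (c ` T)"
  have "m \<in> c ` T"
    unfolding m_def using T by (intro Min_in) auto
  then have "m > 0"
    using c by blast
  have m: "\<And>k. k \<in> T \<Longrightarrow> m \<le> c k"
    unfolding m_def using T(1) by simp
  \<comment> \<open>The bound 1/2 keeps \<open>1 + \<alpha> l\<close> above 1/2, so dividing by it
    at most doubles \<open>c l\<close>. The other bound keeps the correction to \<open>c k\<close>
    below the least coefficient \<open>m\<close>.\<close>
  define \<eta> where "\<eta> = min (1/2) (m / (2 * c l))"
  have "\<eta> > 0"
    unfolding \<eta>_def using \<open>m > 0\<close> c[OF T(2)] by simp
  then obtain \<delta> where "\<delta> > 0" and \<delta>: "\<forall>e\<in>Rn d. (\<forall>i<d. \<bar>e i\<bar> < \<delta>) \<longrightarrow>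
      (\<exists>\<alpha>. e = (\<Sum>k\<in>T. \<alpha> k *\<^sub>R u k) \<and> (\<forall>k\<in>T. \<bar>\<alpha> k\<bar> < \<eta>))"
    using small_coefficients[OF T(1) sp] by blast
  have "pos_rep d T (u(l := w)) b" if w: "w \<in> Rn d" "\<forall>i<d. \<bar>w i - u l i\<bar> < \<delta>" for w
  proof -
    have "w - u l \<in> Rn d"
      using w(1) ul subspace_Rn subspace_diff by blast
    then obtain \<alpha> where \<alpha>: "w - u l = (\<Sum>k\<in>T. \<alpha> k *\<^sub>R u k)" "\<forall>k\<in>T. \<bar>\<alpha> k\<bar> < \<eta>"
      using \<delta>[rule_format, of "w - u l"] w(2) by auto
    have al: "1 + \<alpha> l > 1/2"
      using bspec[OF \<alpha>(2) T(2)] by (auto simp: \<eta>_def)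
    let ?T = "T - {l}"
    have split: "(\<Sum>k\<in>T. g k *\<^sub>R v k) = g l *\<^sub>R v l + (\<Sum>k\<in>?T. g k *\<^sub>R v k)"
      for g :: "_ \<Rightarrow> real" and v :: "_ \<Rightarrow> nat \<Rightarrow> real"
      using T by (rule sum.remove)
    have w_eq: "w = (1 + \<alpha> l) *\<^sub>R u l + (\<Sum>k\<in>?T. \<alpha> k *\<^sub>R u k)"
      using \<alpha>(1) unfolding split by (simp add: algebra_simps)
    \<comment> \<open>These are the new coefficients after substituting for \<open>u l\<close> the
      solution of \<open>w_eq\<close>. They serve both spanning and positivity.\<close>
    define r where "r g k = (if k = l then g l / (1 + \<alpha> l) else g k - g l / (1 + \<alpha> l) * \<alpha> k)" for g k
    have rep: "(\<Sum>k\<in>T. g k *\<^sub>R u k) = (\<Sum>k\<in>T. r g k *\<^sub>R (u(l := w)) k)" for g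
    proof -
      have "(\<Sum>k\<in>T. r g k *\<^sub>R (u(l := w)) k)
          = (g l / (1 + \<alpha> l)) *\<^sub>R w + (\<Sum>k\<in>?T. (g k - g l / (1 + \<alpha> l) * \<alpha> k) *\<^sub>R u k)"
        unfolding split by (auto simp: r_def intro!: sum.cong arg_cong2[where f="(+)"])
      also have "(\<Sum>k\<in>?T. (g k - g l / (1 + \<alpha> l) * \<alpha> k) *\<^sub>R u k)
          = (\<Sum>k\<in>?T. g k *\<^sub>R u k) - (g l / (1 + \<alpha> l)) *\<^sub>R (\<Sum>k\<in>?T. \<alpha> k *\<^sub>R u k)"
        by (simp add: scaleR_diff_left sum_subtractf scaleR_sum_right)
      also have "(g l / (1 + \<alpha> l)) *\<^sub>R w + \<dots> = g l *\<^sub>R u l + (\<Sum>k\<in>?T. g k *\<^sub>R u k)"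
        using al unfolding w_eq by (simp add: scaleR_add_right)
      finally show ?thesis
        unfolding split[of g] by (rule sym)
    qed
    have "r c k > 0" if "k \<in> T" for k
    proof (cases "k = l")
      case True
      then show ?thesis
        using al c[OF T(2)] by (simp add: r_def)
    next
      case False
      have "c l / (1 + \<alpha> l) * \<alpha> k \<le> c l / (1 + \<alpha> l) * \<bar>\<alpha> k\<bar>"
        using al c[OF T(2)] by (intro mult_left_mono) auto
      also have "\<dots> \<le> (2 * c l) * \<bar>\<alpha> k\<bar>"
      proof (rule mult_right_mono)
        show "c l / (1 + \<alpha> l) \<le> 2 * c l"
          using divide_left_mono[of "1/2" "1 + \<alpha> l" "c l"] al c[OF T(2)] by simp
      qed simp
      also have "\<dots> < (2 * c l) * \<eta>"
        using bspec[OF \<alpha>(2) that] c[OF T(2)] by (intro mult_strict_left_mono) auto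
      also have "\<dots> \<le> (2 * c l) * (m / (2 * c l))"
        using c[OF T(2)] by (intro mult_left_mono) (auto simp: \<eta>_def)
      also have "\<dots> \<le> c k"
        using m[OF that] c[OF T(2)] by simp
      finally show ?thesis
        using False by (simp add: r_def)
    qed
    then have "\<exists>c. (\<forall>k\<in>T. c k > 0) \<and> b = (\<Sum>k\<in>T. c k *\<^sub>R (u(l := w)) k)"
      unfolding b rep[of c] by blast
    moreover have "\<forall>x\<in>Rn d. \<exists>\<alpha>. x = (\<Sum>k\<in>T. \<alpha> k *\<^sub>R (u(l := w)) k)"
      using sp unfolding rep by blast
    ultimately show ?thesis
      unfolding pos_rep_def by blast
  qed
  with \<open>\<delta> > 0\<close> show ?thesis by blast
qed

text \<open>The vectors are moved one at a time, by induction on the set \<open>S\<close> of those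
  already moved; the admissible distance at each stage depends on the earlier moves.\<close>

lemma pos_rep_perturb_all:
  assumes T: "finite T" and pr: "pos_rep d T u b" and u: "\<And>l. l \<in> T \<Longrightarrow> u l \<in> Rn d"
    and X: "\<And>l. l \<in> T \<Longrightarrow> X l \<subseteq> Rn d" "\<And>l. l \<in> T \<Longrightarrow> adherent d (X l) (u l)"
  obtains v where "pos_rep d T v b" "\<And>l. l \<in> T \<Longrightarrow> v l \<in> X l"
proof -
  have "\<exists>v. pos_rep d T v b \<and> (\<forall>l\<in>S. v l \<in> X l) \<and> (\<forall>l\<in>T - S. v l = u l)"
    if "finite S" "S \<subseteq> T" for S
    using that
  proof (induction S rule: finite_induct)
    case empty
    then show ?case using pr by auto
  next
    case (insert l S)
    then obtain v where v: "pos_rep d T v b" "\<forall>l\<in>S. v l \<in> X l" "\<forall>l\<in>T - S. v l = u l"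
      by auto
    have l: "l \<in> T" "v l = u l"
      using insert v(3) by auto
    obtain \<delta> where "\<delta> > 0" and \<delta>: "\<forall>w\<in>Rn d. (\<forall>i<d. \<bar>w i - v l i\<bar> < \<delta>) \<longrightarrow> pos_rep d T (v(l := w)) b"
      using pos_rep_perturb[OF T l(1) v(1)] l u by auto
    obtain w where w: "w \<in> X l" "\<forall>i<d. \<bar>w i - u l i\<bar> < \<delta>"
      using X(2)[OF l(1)] \<open>\<delta> > 0\<close> unfolding adherent_def by blast
    have "pos_rep d T (v(l := w)) b"
      using \<delta> w X(1)[OF l(1)] l(2) by auto
    moreover have "\<forall>k\<in>insert l S. (v(l := w)) k \<in> X k"
      using v(2) w(1) by auto
    moreover have "\<forall>k\<in>T - insert l S. (v(l := w)) k = u k"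
      using v(3) by auto
    ultimately show ?case by blast
  qed
  from this[OF T order_refl] show ?thesis
    using that by auto
qed

section \<open>Common closure points cannot span around an encapsulated point\<close>

text \<open>Let \<open>v\<close> be the sum of a basis \<open>B\<close> contained in
  \<open>S - a\<close>. The point \<open>y = a - \<epsilon> v\<close> near \<open>a\<close> lies in
  some \<open>K j\<close>. Since \<open>K j\<close> comes arbitrarily close to each
  \<open>a + k\<close> with \<open>k \<in> B\<close>, it also contains a point on the ray from
  \<open>a\<close> in direction \<open>v\<close>. By convexity \<open>a \<in> K j\<close>, a
  contradiction.\<close>

lemma no_adherent_spanning_set:
  assumes "d \<ge> 1" and K: "\<And>j. j \<in> J \<Longrightarrow> convex (K j)" "\<And>j. j \<in> J \<Longrightarrow> K j \<subseteq> Rn d"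
    and a: "punctured_nhd d (\<Union>j\<in>J. K j) a" and S: "S \<subseteq> Rn d"
    and ad: "\<And>s j. s \<in> S \<Longrightarrow> j \<in> J \<Longrightarrow> adherent d (K j) s"
  shows "\<not> Rn d \<subseteq> span ((\<lambda>s. s - a) ` S)"
proof
  assume sp: "Rn d \<subseteq> span ((\<lambda>s. s - a) ` S)"
  have aR: "a \<in> Rn d" and aK: "\<And>j. j \<in> J \<Longrightarrow> a \<notin> K j"
    using a by (auto simp: punctured_nhd_def)
  obtain B where B: "B \<subseteq> (\<lambda>s. s - a) ` S" "independent B" "(\<lambda>s. s - a) ` S \<subseteq> span B"
    using maximal_independent_subset by blast
  have spB: "Rn d \<subseteq> span B"
    using sp span_minimal[OF B(3) subspace_span] by blast
  have BR: "B \<subseteq> Rn d"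
    using B(1) S aR subspace_diff[OF subspace_Rn] by blast
  have fin: "finite B"
    using independent_Rn B(2) BR by blast
  \<comment> \<open>Here \<open>d \<ge> 1\<close> enters: with an empty basis \<open>v\<close> would
    be 0 and \<open>y\<close> would be \<open>a\<close> itself.\<close>
  have "B \<noteq> {}"
  proof
    assume "B = {}"
    moreover have "(\<lambda>j::nat. of_bool (j = 0) :: real) \<in> Rn d"
      using \<open>d \<ge> 1\<close> by (auto simp: Rn_iff)
    ultimately have "(\<lambda>j::nat. of_bool (j = 0) :: real) = 0"
      using spB by auto
    then show False
      by (auto dest: fun_cong[of _ _ 0])
  qed
  define v where "v = (\<Sum>k\<in>B. k)"
  have "v \<noteq> 0"
  proof
    assume "v = 0"
    obtain k where "k \<in> B"
      using \<open>B \<noteq> {}\<close> by blast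
    then show False
      using independentD[OF B(2) fin order_refl, of "\<lambda>_. 1" k] \<open>v = 0\<close> by (simp add: v_def)
  qed
  have vR: "v \<in> Rn d"
    unfolding v_def using BR by (intro subspace_sum[OF subspace_Rn]) auto
  obtain \<delta> where "\<delta> > 0" and \<delta>: "\<forall>x\<in>Rn d. x \<noteq> a \<longrightarrow> (\<forall>i<d. \<bar>x i - a i\<bar> < \<delta>) \<longrightarrow> x \<in> (\<Union>j\<in>J. K j)"
    using a unfolding punctured_nhd_def by blast
  define C where "C = (\<Sum>i<d. \<bar>v i\<bar>)"
  have "C \<ge> 0"
    unfolding C_def by (intro sum_nonneg) auto
  define \<epsilon> where "\<epsilon> = \<delta> / (C + 1)"
  have "\<epsilon> > 0"
    unfolding \<epsilon>_def using \<open>C \<ge> 0\<close> \<open>\<delta> > 0\<close> by simp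
  define y where "y = a - \<epsilon> *\<^sub>R v"
  have "y \<in> (\<Union>j\<in>J. K j)"
  proof (rule \<delta>[rule_format])
    show "y \<in> Rn d"
      unfolding y_def using aR vR by (intro subspace_diff[OF subspace_Rn] subspace_scale[OF subspace_Rn])
    show "y \<noteq> a"
      unfolding y_def using \<open>\<epsilon> > 0\<close> \<open>v \<noteq> 0\<close> by simp
    fix i assume "i < d"
    then have "\<bar>v i\<bar> \<le> C"
      unfolding C_def by (intro member_le_sum) auto
    then have "\<epsilon> * \<bar>v i\<bar> \<le> \<epsilon> * C"
      using \<open>\<epsilon> > 0\<close> by simp
    also have "\<dots> < \<delta>"
      unfolding \<epsilon>_def using \<open>C \<ge> 0\<close> \<open>\<delta> > 0\<close> by (simp add: field_simps)
    finally show "\<bar>y i - a i\<bar> < \<delta>"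
      using \<open>\<epsilon> > 0\<close> by (simp add: y_def abs_mult)
  qed
  then obtain j where j: "j \<in> J" "y \<in> K j" by blast
  define X where "X = (\<lambda>x. x - a) ` K j"
  have "pos_rep d B (\<lambda>k. k) (\<epsilon> *\<^sub>R v)"
    unfolding pos_rep_def
  proof (intro conjI ballI)
    fix x assume "x \<in> Rn d"
    then have "x \<in> span B"
      using spB by blast
    then show "\<exists>\<alpha>. x = (\<Sum>k\<in>B. \<alpha> k *\<^sub>R k)"
      using span_finite[OF fin] by auto
  next
    show "\<exists>c. (\<forall>k\<in>B. c k > 0) \<and> \<epsilon> *\<^sub>R v = (\<Sum>k\<in>B. c k *\<^sub>R k)"
      unfolding v_def using \<open>\<epsilon> > 0\<close> by (intro exI[of _ "\<lambda>_. \<epsilon>"]) (simp add: scaleR_sum_right)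
  qed
  moreover have "X \<subseteq> Rn d"
    unfolding X_def using K(2)[OF j(1)] aR subspace_diff[OF subspace_Rn] by blast
  moreover have "adherent d X k" if k: "k \<in> B" for k
    unfolding adherent_def
  proof (intro allI impI)
    fix \<eta> :: real assume "\<eta> > 0"
    obtain s where s: "s \<in> S" "k = s - a"
      using B(1) k by blast
    obtain x where "x \<in> K j" "\<forall>i<d. \<bar>x i - s i\<bar> < \<eta>"
      using ad[OF s(1) j(1)] \<open>\<eta> > 0\<close> unfolding adherent_def by blast
    then show "\<exists>x\<in>X. \<forall>i<d. \<bar>x i - k i\<bar> < \<eta>"
      unfolding X_def s(2) by (intro bexI[of _ "x - a"]) auto
  qed
  ultimately obtain w where w: "pos_rep d B w (\<epsilon> *\<^sub>R v)" "\<And>k. k \<in> B \<Longrightarrow> w k \<in> X"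
    using pos_rep_perturb_all[OF fin, of d "\<lambda>k. k" "\<epsilon> *\<^sub>R v" "\<lambda>_. X"] BR by blast
  obtain c where c: "\<And>k. k \<in> B \<Longrightarrow> c k > 0" "\<epsilon> *\<^sub>R v = (\<Sum>k\<in>B. c k *\<^sub>R w k)"
    using w(1) unfolding pos_rep_def by blast
  \<comment> \<open>Dividing by the total weight \<open>D\<close> turns the positive combination
    into a convex one, and the resulting point of \<open>K j\<close> is
    \<open>a + (\<epsilon> / D) v\<close>.\<close>
  define D where "D = sum c B"
  have "D > 0"
    unfolding D_def using c(1) fin \<open>B \<noteq> {}\<close> by (intro sum_pos)
  have z: "(\<Sum>k\<in>B. (c k / D) *\<^sub>R (a + w k)) \<in> K j"
  proof (rule convex_sum[OF fin K(1)[OF j(1)]])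
    show "(\<Sum>k\<in>B. c k / D) = 1"
      using \<open>D > 0\<close> by (simp add: sum_divide_distrib[symmetric] D_def)
    show "c k / D \<ge> 0" if "k \<in> B" for k
      using c(1)[OF that] \<open>D > 0\<close> by simp
    show "a + w k \<in> K j" if "k \<in> B" for k
      using w(2)[OF that] by (auto simp: X_def)
  qed
  have "D *\<^sub>R (\<Sum>k\<in>B. (c k / D) *\<^sub>R (a + w k)) = (\<Sum>k\<in>B. c k *\<^sub>R (a + w k))"
    using \<open>D > 0\<close> by (simp add: scaleR_sum_right)
  also have "\<dots> = D *\<^sub>R a + \<epsilon> *\<^sub>R v"
    unfolding c(2) D_def by (simp add: scaleR_add_right sum.distrib scaleR_sum_left)
  finally have z_eq: "D *\<^sub>R (\<Sum>k\<in>B. (c k / D) *\<^sub>R (a + w k)) = D *\<^sub>R a + \<epsilon> *\<^sub>R v" .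
  \<comment> \<open>With these weights the displacements of \<open>y\<close> and of the new point
    from \<open>a\<close> cancel.\<close>
  have "1 / (1 + D) + D / (1 + D) = 1"
    using \<open>D > 0\<close> by (simp add: divide_simps)
  then have "(1 / (1 + D)) *\<^sub>R y + (D / (1 + D)) *\<^sub>R (\<Sum>k\<in>B. (c k / D) *\<^sub>R (a + w k)) \<in> K j"
    using \<open>D > 0\<close> by (intro convexD[OF K(1)[OF j(1)]] j z) simp_all
  moreover have "(1 / (1 + D)) *\<^sub>R y + (D / (1 + D)) *\<^sub>R (\<Sum>k\<in>B. (c k / D) *\<^sub>R (a + w k))
      = (1 / (1 + D)) *\<^sub>R (y + D *\<^sub>R (\<Sum>k\<in>B. (c k / D) *\<^sub>R (a + w k)))"
    by (simp add: scaleR_add_right)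
  moreover have "\<dots> = (1 / (1 + D)) *\<^sub>R ((1 + D) *\<^sub>R a)"
    unfolding z_eq y_def by (simp add: scaleR_add_left)
  moreover have "\<dots> = a"
    using \<open>D > 0\<close> by simp
  ultimately show False
    using aK[OF j(1)] by simp
qed

subsection \<open>Counting encapsulated points\<close>

lemma ecard_empty [simp]: "ecard {} = 0"
  by (simp add: ecard_def flip: zero_enat_def)

lemma ecard_mono: "A \<subseteq> B \<Longrightarrow> ecard A \<le> ecard B"
  by (auto simp: ecard_def card_mono dest: finite_subset)

lemma ecard_Un_le: "ecard (A \<union> B) \<le> ecard A + ecard B"
  by (auto simp: ecard_def card_Un_le)

lemma ecard_image: "inj_on g A \<Longrightarrow> ecard (g ` A) = ecard A"
  by (simp add: ecard_def finite_image_iff card_image)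

lemma ecard_UN_le:
  assumes "finite I" "\<And>i. i \<in> I \<Longrightarrow> ecard (A i) \<le> c"
  shows "ecard (\<Union>i\<in>I. A i) \<le> of_nat (card I) * c"
  using assms
proof (induction I rule: finite_induct)
  case empty
  show ?case by simp
next
  case (insert i I)
  have "ecard (\<Union>i\<in>insert i I. A i) \<le> ecard (A i) + ecard (\<Union>i\<in>I. A i)"
    using ecard_Un_le by simp
  also have "\<dots> \<le> c + of_nat (card I) * c"
    using insert by (intro add_mono) auto
  finally show ?case
    using insert by (simp add: distrib_right)
qed

lemma ecard_encapsulated_le:
  "convex_family d n K \<Longrightarrow> ecard {p. encapsulated d n K p} \<le> max_encapsulated d n"
  unfolding max_encapsulated_def by (intro SUP_upper) simp

text \<open>Subfamilies arise with index sets such as \<open>{1..n}-{i}\<close>; an enumeration of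
  \<open>J\<close> renumbers them from 1.\<close>

lemma ecard_punctured_nhd_le:
  assumes "finite J" "\<And>j. j \<in> J \<Longrightarrow> convex (K j)" "\<And>j. j \<in> J \<Longrightarrow> K j \<subseteq> Rn d"
  shows "ecard {p. punctured_nhd d (\<Union>j\<in>J. K j) p} \<le> max_encapsulated d (card J)"
proof -
  obtain h where h: "bij_betw h {1..card J} J"
    using ex_bij_betw_nat_finite_1[OF assms(1)] by blast
  then have hJ: "h ` {1..card J} = J"
    by (simp add: bij_betw_def)
  then have "convex_family d (card J) (K \<circ> h)"
    unfolding convex_family_def comp_def using assms(2,3) bij_betwE[OF h] by blast
  moreover have "(\<Union>i\<in>{1..card J}. (K \<circ> h) i) = (\<Union>j\<in>h ` {1..card J}. K j)"
    by simp
  ultimately show ?thesis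
    using ecard_encapsulated_le[of d "card J" "K \<circ> h"] by (simp only: encapsulated_iff hJ)
qed

text \<open>The flat \<open>p0 + span B\<close> is parametrized by an affine injection
  \<open>\<phi>\<close> of \<open>Rn m\<close>, with \<open>m = card B\<close>. Preimages of convex
  sets are convex, and the preimage of an encapsulated point stays encapsulated because
  \<open>\<phi>\<close> is injective and Lipschitz.\<close>

lemma ecard_flat_le:
  assumes K: "convex_family d n K" and Q: "Q \<subseteq> {p. encapsulated d n K p}"
    and B: "finite B" "independent B" "\<And>p. p \<in> Q \<Longrightarrow> p - p0 \<in> span B"
    and R: "p0 \<in> Rn d" "B \<subseteq> Rn d"
  shows "ecard Q \<le> max_encapsulated (card B) n"
proof -
  define m where "m = card B"
  obtain b where b: "bij_betw b {..<m} B"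
    using ex_bij_betw_nat_finite[OF B(1)] by (auto simp: m_def atLeast0LessThan)
  define \<phi> where "\<phi> x = p0 + (\<Sum>k<m. x k *\<^sub>R b k)" for x :: "nat \<Rightarrow> real"
  have bR: "b k \<in> Rn d" if "k < m" for k
    using b that R(2) by (auto simp: bij_betw_def)
  have \<phi>R: "\<phi> x \<in> Rn d" for x
    unfolding \<phi>_def using bR R(1)
    by (intro subspace_add[OF subspace_Rn] subspace_sum[OF subspace_Rn] subspace_scale[OF subspace_Rn]) auto
  have \<phi>_inj: "x = y" if x: "x \<in> Rn m" and y: "y \<in> Rn m" and eq: "\<phi> x = \<phi> y" for x y
  proof
    fix k
    show "x k = y k"
    proof (cases "k < m")
      case False
      then show ?thesis
        using x y by (simp add: Rn_iff)
    next
      case True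
      \<comment> \<open>The inverse enumeration turns the sum over \<open>k < m\<close> into a sum
        over \<open>B\<close>, where independence applies.\<close>
      define b' where "b' = the_inv_into {..<m} b"
      have b': "b' (b k) = k" if "k < m" for k
        using b that by (simp add: b'_def bij_betw_def the_inv_into_f_f)
      have "(\<Sum>k<m. (x k - y k) *\<^sub>R b k) = 0"
        using eq by (simp add: \<phi>_def scaleR_diff_left sum_subtractf)
      moreover have "(\<Sum>k<m. (x k - y k) *\<^sub>R b k) = (\<Sum>v\<in>B. (x (b' v) - y (b' v)) *\<^sub>R v)"
        by (subst sum.reindex_bij_betw[OF b, symmetric]) (simp add: b')
      ultimately have "x (b' (b k)) - y (b' (b k)) = 0"
        using independentD[OF B(2,1) order_refl, of "\<lambda>v. x (b' v) - y (b' v)" "b k"] b True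
        by (auto simp: bij_betw_def)
      then show ?thesis
        using b'[OF True] by simp
    qed
  qed
  have "\<exists>x\<in>Rn m. \<phi> x = p" if p: "p \<in> Q" for p
  proof -
    obtain u where u: "p - p0 = (\<Sum>v\<in>B. u v *\<^sub>R v)"
      using B(3)[OF p] unfolding span_finite[OF B(1)] by auto
    also have "\<dots> = (\<Sum>k<m. u (b k) *\<^sub>R b k)"
      using sum.reindex_bij_betw[OF b, of "\<lambda>v. u v *\<^sub>R v"] by simp
    finally have "\<phi> (\<lambda>k. if k < m then u (b k) else 0) = p"
      by (simp add: \<phi>_def algebra_simps)
    then show ?thesis
      by (intro bexI[of _ "\<lambda>k. if k < m then u (b k) else 0"]) (auto simp: Rn_iff)
  qed
  then obtain g where g: "\<And>p. p \<in> Q \<Longrightarrow> g p \<in> Rn m" "\<And>p. p \<in> Q \<Longrightarrow> \<phi> (g p) = p"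
    by metis
  define K' where "K' i = {x \<in> Rn m. \<phi> x \<in> K i}" for i
  have "convex_family m n K'"
    unfolding convex_family_def
  proof (intro ballI conjI)
    fix i assume i: "i \<in> {1..n}"
    show "K' i \<subseteq> Rn m"
      by (auto simp: K'_def)
    show "convex (K' i)"
    proof (rule convexI)
      fix x y :: "nat \<Rightarrow> real" and s t :: real
      assume xy: "x \<in> K' i" "y \<in> K' i" and st: "0 \<le> s" "0 \<le> t" "s + t = 1"
      have "p0 = s *\<^sub>R p0 + t *\<^sub>R p0"
        using st by (simp flip: scaleR_add_left)
      then have "\<phi> (s *\<^sub>R x + t *\<^sub>R y) = s *\<^sub>R \<phi> x + t *\<^sub>R \<phi> y"
        by (simp add: \<phi>_def scaleR_add_left scaleR_add_right scaleR_sum_right sum.distrib)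
      also have "\<dots> \<in> K i"
        using K i xy st by (intro convexD) (auto simp: convex_family_def K'_def)
      finally show "s *\<^sub>R x + t *\<^sub>R y \<in> K' i"
        using xy subspace_add[OF subspace_Rn] subspace_scale[OF subspace_Rn] by (simp add: K'_def)
    qed
  qed
  then have bound: "ecard {q. encapsulated m n K' q} \<le> max_encapsulated m n"
    by (rule ecard_encapsulated_le)
  have sub: "g ` Q \<subseteq> {q. encapsulated m n K' q}"
  proof safe
    fix p assume p: "p \<in> Q"
    then have pn: "punctured_nhd d (\<Union>i\<in>{1..n}. K i) p"
      using Q encapsulated_iff by blast
    obtain \<delta> where "\<delta> > 0" and \<delta>: "\<forall>x\<in>Rn d. x \<noteq> p \<longrightarrow> (\<forall>i<d. \<bar>x i - p i\<bar> < \<delta>) \<longrightarrow> x \<in> (\<Union>i\<in>{1..n}. K i)"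
      using pn unfolding punctured_nhd_def by blast
    \<comment> \<open>\<open>C\<close> is a Lipschitz constant of \<open>\<phi>\<close> for the
      maximum norms.\<close>
    define C where "C = (\<Sum>i<d. \<Sum>k<m. \<bar>b k i\<bar>)"
    have "C \<ge> 0"
      unfolding C_def by (intro sum_nonneg) auto
    have "x \<in> (\<Union>i\<in>{1..n}. K' i)"
      if x: "x \<in> Rn m" "x \<noteq> g p" "\<forall>k<m. \<bar>x k - g p k\<bar> < \<delta> / (C + 1)" for x
    proof -
      have "\<phi> x \<in> (\<Union>i\<in>{1..n}. K i)"
      proof (rule \<delta>[rule_format, OF \<phi>R])
        show "\<phi> x \<noteq> p"
          using \<phi>_inj[OF x(1) g(1)[OF p]] x(2) g(2)[OF p] by auto
        fix i assume "i < d"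
        have "\<phi> x i - p i = \<phi> x i - \<phi> (g p) i"
          using g(2)[OF p] by simp
        also have "\<dots> = (\<Sum>k<m. (x k - g p k) * b k i)"
          by (simp add: \<phi>_def sum_fun_apply left_diff_distrib sum_subtractf)
        finally have "\<bar>\<phi> x i - p i\<bar> \<le> (\<Sum>k<m. \<bar>x k - g p k\<bar> * \<bar>b k i\<bar>)"
          using sum_abs[of "\<lambda>k. (x k - g p k) * b k i" "{..<m}"] by (simp add: abs_mult)
        also have "\<dots> \<le> (\<Sum>k<m. \<delta> / (C + 1) * \<bar>b k i\<bar>)"
          using x(3) by (intro sum_mono mult_right_mono) (auto intro: less_imp_le)
        also have "\<dots> = \<delta> / (C + 1) * (\<Sum>k<m. \<bar>b k i\<bar>)"
          by (simp add: sum_distrib_left)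
        also have "\<dots> \<le> \<delta> / (C + 1) * C"
          unfolding C_def using \<open>i < d\<close> \<open>C \<ge> 0\<close> \<open>\<delta> > 0\<close>
          by (intro mult_left_mono member_le_sum[of i "{..<d}" "\<lambda>i. \<Sum>k<m. \<bar>b k i\<bar>"])
            (auto intro: sum_nonneg simp: C_def)
        also have "\<dots> < \<delta>"
          using \<open>C \<ge> 0\<close> \<open>\<delta> > 0\<close> by (simp add: field_simps)
        finally show "\<bar>\<phi> x i - p i\<bar> < \<delta>" .
      qed
      then show ?thesis
        using x(1) by (auto simp: K'_def)
    qed
    moreover have "\<delta> / (C + 1) > 0"
      using \<open>C \<ge> 0\<close> \<open>\<delta> > 0\<close> by simp
    moreover have "g p \<notin> (\<Union>i\<in>{1..n}. K' i)"
      using pn g(2)[OF p] by (auto simp: K'_def punctured_nhd_def)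
    ultimately have "punctured_nhd m (\<Union>i\<in>{1..n}. K' i) (g p)"
      unfolding punctured_nhd_def using g(1)[OF p] by blast
    then show "encapsulated m n K' (g p)"
      by (simp add: encapsulated_iff)
  qed
  have "inj_on g Q"
    by (metis g(2) inj_onI)
  then have "ecard Q = ecard (g ` Q)"
    by (simp add: ecard_image)
  also have "\<dots> \<le> ecard {q. encapsulated m n K' q}"
    using sub by (rule ecard_mono)
  also note bound
  finally show ?thesis
    unfolding m_def .
qed

section \<open>Points that need all the sets\<close>

text \<open>The set \<open>E\<close> of the overview. \<open>punctured_nhd\<close> takes the index
  set \<open>{1..n}-{i}\<close> without renumbering.\<close>

definition essential_points :: "nat \<Rightarrow> nat \<Rightarrow> (nat \<Rightarrow> (nat \<Rightarrow> real) set) \<Rightarrow> (nat \<Rightarrow> real) set"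
  where "essential_points d n K =
    {p. encapsulated d n K p \<and> (\<forall>i\<in>{1..n}. \<not> punctured_nhd d (\<Union>j\<in>{1..n}-{i}. K j) p)}"

text \<open>A point that is not essential stays encapsulated when some \<open>K i\<close> is
  dropped, and there are \<open>n\<close> choices of \<open>i\<close>.\<close>

lemma ecard_encapsulated_split:
  assumes K: "convex_family d n K"
  shows "ecard {p. encapsulated d n K p}
    \<le> of_nat n * max_encapsulated d (n - 1) + ecard (essential_points d n K)"
    (is "ecard ?A \<le> _ + ecard ?E")
proof -
  have "ecard ?A \<le> ecard ((\<Union>i\<in>{1..n}. {p. punctured_nhd d (\<Union>j\<in>{1..n}-{i}. K j) p}) \<union> ?E)"
    by (intro ecard_mono) (auto simp: essential_points_def)
  also have "\<dots> \<le> ecard (\<Union>i\<in>{1..n}. {p. punctured_nhd d (\<Union>j\<in>{1..n}-{i}. K j) p}) + ecard ?E"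
    by (rule ecard_Un_le)
  also have "ecard (\<Union>i\<in>{1..n}. {p. punctured_nhd d (\<Union>j\<in>{1..n}-{i}. K j) p})
      \<le> of_nat (card {1..n}) * max_encapsulated d (n - 1)"
  proof (rule ecard_UN_le)
    fix i assume "i \<in> {1..n}"
    then have "card ({1..n} - {i}) = n - 1" by simp
    then show "ecard {p. punctured_nhd d (\<Union>j\<in>{1..n}-{i}. K j) p} \<le> max_encapsulated d (n - 1)"
      using K ecard_punctured_nhd_le[of "{1..n} - {i}" K d] by (auto simp: convex_family_def)
  qed simp
  finally show ?thesis
    by (simp add: add_mono)
qed

text \<open>If \<open>K i\<close> avoided a cube around \<open>p\<close>, the other sets alone would
  cover a punctured cube.\<close>

lemma adherent_if_needed:
  assumes "punctured_nhd d (\<Union>j\<in>J. K j) p" "\<not> punctured_nhd d (\<Union>j\<in>J-{i}. K j) p"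
  shows "adherent d (K i) p"
proof (rule ccontr)
  assume "\<not> adherent d (K i) p"
  then obtain \<delta>1 where "\<delta>1 > 0" and \<delta>1: "\<And>x. x \<in> K i \<Longrightarrow> \<not> (\<forall>i<d. \<bar>x i - p i\<bar> < \<delta>1)"
    unfolding adherent_def by blast
  obtain \<delta> where "\<delta> > 0" and \<delta>: "\<forall>x\<in>Rn d. x \<noteq> p \<longrightarrow> (\<forall>i<d. \<bar>x i - p i\<bar> < \<delta>) \<longrightarrow> x \<in> (\<Union>j\<in>J. K j)"
    using assms(1) unfolding punctured_nhd_def by blast
  have "\<forall>x\<in>Rn d. x \<noteq> p \<longrightarrow> (\<forall>i<d. \<bar>x i - p i\<bar> < min \<delta> \<delta>1) \<longrightarrow> x \<in> (\<Union>j\<in>J-{i}. K j)"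
    using \<delta> \<delta>1 by fastforce
  moreover have "min \<delta> \<delta>1 > 0"
    using \<open>\<delta> > 0\<close> \<open>\<delta>1 > 0\<close> by simp
  moreover have "p \<in> Rn d" "p \<notin> (\<Union>j\<in>J-{i}. K j)"
    using assms(1) by (auto simp: punctured_nhd_def)
  ultimately show False
    using assms(2) unfolding punctured_nhd_def by blast
qed

text \<open>\<open>B\<close> is a maximal independent subset of \<open>E - p0\<close>. The
  obstruction at \<open>p0\<close> excludes \<open>card B = d\<close>. If
  \<open>card B = d - 1\<close>, an encapsulated \<open>a\<close> off the hyperplane would complete
  \<open>B\<close> to a basis, and \<open>E - a\<close> would span, against the obstruction at
  \<open>a\<close>.\<close>

lemma essential_points_flat:
  assumes "d \<ge> 1" and K: "convex_family d n K" and ne: "essential_points d n K \<noteq> {}"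
  obtains p0 B where "p0 \<in> Rn d" "B \<subseteq> Rn d" "finite B" "independent B" "card B < d"
    "\<And>p. p \<in> essential_points d n K \<Longrightarrow> p - p0 \<in> span B"
    "\<And>p. card B = d - 1 \<Longrightarrow> encapsulated d n K p \<Longrightarrow> p - p0 \<in> span B"
proof -
  define E where "E = essential_points d n K"
  have E: "E \<subseteq> {p. encapsulated d n K p}"
    by (auto simp: E_def essential_points_def)
  have ad: "adherent d (K i) p" if "p \<in> E" "i \<in> {1..n}" for p i
    using that by (intro adherent_if_needed[of d K "{1..n}"]) (auto simp: E_def essential_points_def encapsulated_iff)
  obtain p0 where p0: "p0 \<in> E"
    using ne unfolding E_def by blast
  have ER: "E \<subseteq> Rn d"
    using E by (auto simp: encapsulated_def)
  obtain B where B: "B \<subseteq> (\<lambda>p. p - p0) ` E" "independent B" "(\<lambda>p. p - p0) ` E \<subseteq> span B"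
    using maximal_independent_subset by blast
  have BR: "B \<subseteq> Rn d"
    using B(1) ER p0 subspace_diff[OF subspace_Rn] by blast
  note BC = independent_Rn[OF B(2) BR]
  \<comment> \<open>This holds at every encapsulated \<open>a\<close>, not only at those in
    \<open>E\<close>, which the last claim relies on.\<close>
  have no_span: "\<not> Rn d \<subseteq> span ((\<lambda>p. p - a) ` E)" if "encapsulated d n K a" for a
    using that K ER ad unfolding encapsulated_iff convex_family_def
    by (intro no_adherent_spanning_set[OF \<open>d \<ge> 1\<close>, of "{1..n}" K]) auto
  have "card B \<noteq> d"
  proof
    assume "card B = d"
    then have "Rn d \<subseteq> span ((\<lambda>p. p - p0) ` E)"
      using independent_card_spans_Rn[OF B(2) BR] span_mono[OF B(1)] by blast
    then show False
      using no_span p0 E by blast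
  qed
  have "a - p0 \<in> span B" if c: "card B = d - 1" and a: "encapsulated d n K a" for a
  proof (rule ccontr)
    assume n: "a - p0 \<notin> span B"
    have "a - p0 \<in> Rn d"
      using a ER p0 subspace_diff[OF subspace_Rn] by (auto simp: encapsulated_def)
    moreover have "a - p0 \<notin> B"
      using n span_base by blast
    ultimately have "insert (a - p0) B \<subseteq> Rn d" "card (insert (a - p0) B) = d"
      using BR BC(1) c \<open>d \<ge> 1\<close> by auto
    then have "Rn d \<subseteq> span (insert (a - p0) B)"
      by (rule independent_card_spans_Rn[OF independent_insertI[OF n B(2)]])
    \<comment> \<open>The base point changes from \<open>p0\<close> to \<open>a\<close>:
      \<open>p - p0\<close> is \<open>(p - a) - (p0 - a)\<close>, and \<open>a - p0\<close> is
      \<open>-(p0 - a)\<close>.\<close>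
    moreover have "insert (a - p0) B \<subseteq> span ((\<lambda>p. p - a) ` E)"
    proof -
      have s: "p - a \<in> span ((\<lambda>p. p - a) ` E)" if "p \<in> E" for p
        using that by (intro span_base) auto
      have "p - p0 \<in> span ((\<lambda>p. p - a) ` E)" if "p \<in> E" for p
        using span_diff[OF s[OF that] s[OF p0]] by simp
      moreover have "a - p0 \<in> span ((\<lambda>p. p - a) ` E)"
        using span_neg[OF s[OF p0]] by simp
      ultimately show ?thesis
        using B(1) by auto
    qed
    ultimately have "Rn d \<subseteq> span ((\<lambda>p. p - a) ` E)"
      using span_minimal[OF _ subspace_span] by blast
    then show False
      using no_span[OF a] by blast
  qed
  moreover have "p0 \<in> Rn d" "card B < d"
    using p0 ER BC(2) \<open>card B \<noteq> d\<close> by auto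
  moreover have "p - p0 \<in> span B" if "p \<in> essential_points d n K" for p
    using B(3) that unfolding E_def by blast
  ultimately show ?thesis
    by (intro that[of p0 B] BR BC(1) B(2))
qed

section \<open>Monotonicity in the dimension\<close>

text \<open>The configuration is placed in the hyperplane \<open>x d = 0\<close>, where
  \<open>x d\<close> is the new coordinate. One open half-space is joined to \<open>K 1\<close> and
  the other to \<open>K 2\<close>, hence \<open>n \<ge> 2\<close>. This covers everything off the
  hyperplane and adds nothing on it.\<close>

lemma max_encapsulated_mono_Suc:
  assumes "n \<ge> 2"
  shows "max_encapsulated d n \<le> max_encapsulated (Suc d) n"
  unfolding max_encapsulated_def[of d]
proof (rule SUP_least)
  fix K assume "K \<in> {K. convex_family d n K}"
  then have K: "\<And>i. i \<in> {1..n} \<Longrightarrow> K i \<subseteq> Rn d" "\<And>i. i \<in> {1..n} \<Longrightarrow> convex (K i)"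
    by (auto simp: convex_family_def)
  define H where "H i = (if i = (1::nat) then {x \<in> Rn (Suc d). x d > 0}
      else if i = 2 then {x \<in> Rn (Suc d). x d < 0} else {})" for i
  have RnS: "x \<in> Rn d \<longleftrightarrow> x \<in> Rn (Suc d) \<and> x d = 0" for x
    unfolding Rn_iff by (metis Suc_le_eq le_less order_refl)
  have "convex (K i \<union> H i)" if i: "i \<in> {1..n}" for i
  proof (rule convexI)
    fix x y :: "nat \<Rightarrow> real" and s t :: real
    assume xy: "x \<in> K i \<union> H i" "y \<in> K i \<union> H i" and st: "0 \<le> s" "0 \<le> t" "s + t = 1"
    show "s *\<^sub>R x + t *\<^sub>R y \<in> K i \<union> H i"
    \<comment> \<open>In the remaining case a point of \<open>H i\<close> has positive weight.
      Points of \<open>K i\<close> have last coordinate 0, so the combination has the sign required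
      by \<open>H i\<close>.\<close>
    proof (cases "s = 0 \<or> t = 0 \<or> (x \<in> K i \<and> y \<in> K i)")
      case True
      then show ?thesis
        using xy st convexD[OF K(2)[OF i]] by auto
    next
      case False
      then have st: "s > 0" "t > 0"
        using st by auto
      have xyR: "x \<in> Rn (Suc d)" "y \<in> Rn (Suc d)"
        using xy K(1)[OF i] RnS by (auto simp: H_def split: if_splits)
      then have "s *\<^sub>R x + t *\<^sub>R y \<in> Rn (Suc d)"
        by (intro subspace_add[OF subspace_Rn] subspace_scale[OF subspace_Rn])
      moreover have Kd: "z d = 0" if "z \<in> K i" for z
        using that K(1)[OF i] RnS by blast
      have "s *\<^sub>R x + t *\<^sub>R y \<in> H i" if "s *\<^sub>R x + t *\<^sub>R y \<in> Rn (Suc d)"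
        using False xy st that Kd[of x] Kd[of y]
        by (auto simp: H_def add_pos_pos add_neg_neg mult_pos_neg split: if_splits)
      ultimately show ?thesis by blast
    qed
  qed
  moreover have "K i \<union> H i \<subseteq> Rn (Suc d)" if "i \<in> {1..n}" for i
    using K(1)[OF that] RnS by (auto simp: H_def)
  ultimately have cf: "convex_family (Suc d) n (\<lambda>i. K i \<union> H i)"
    by (simp add: convex_family_def)
  have "encapsulated (Suc d) n (\<lambda>i. K i \<union> H i) p" if "encapsulated d n K p" for p
  proof -
    obtain \<delta> where p: "p \<in> Rn d" "p \<notin> (\<Union>i\<in>{1..n}. K i)" and "\<delta> > 0"
      and \<delta>: "\<forall>x\<in>Rn d. x \<noteq> p \<longrightarrow> (\<forall>i<d. \<bar>x i - p i\<bar> < \<delta>) \<longrightarrow> x \<in> (\<Union>i\<in>{1..n}. K i)"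
      using \<open>encapsulated d n K p\<close> unfolding encapsulated_iff punctured_nhd_def by blast
    have "x \<in> (\<Union>i\<in>{1..n}. K i \<union> H i)"
      if x: "x \<in> Rn (Suc d)" "x \<noteq> p" "\<forall>i<Suc d. \<bar>x i - p i\<bar> < \<delta>" for x
    proof -
      consider "x d > 0" | "x d < 0" | "x \<in> Rn d"
        using x(1) RnS by fastforce
      then show ?thesis
      proof cases
        case 1
        then have "x \<in> H 1"
          using x(1) by (simp add: H_def)
        then show ?thesis
          using assms by (intro UN_I[of 1]) auto
      next
        case 2
        then have "x \<in> H 2"
          using x(1) by (simp add: H_def)
        then show ?thesis
          using assms by (intro UN_I[of 2]) auto
      next
        case 3
        then show ?thesis
          using \<delta> x by force
      qed
    qed
    moreover have "p \<in> Rn (Suc d)" "p \<notin> (\<Union>i\<in>{1..n}. K i \<union> H i)"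
      using p RnS by (auto simp: H_def split: if_splits)
    ultimately show ?thesis
      unfolding encapsulated_iff punctured_nhd_def using \<open>\<delta> > 0\<close> by blast
  qed
  then have "ecard {p. encapsulated d n K p}
      \<le> ecard {p. encapsulated (Suc d) n (\<lambda>i. K i \<union> H i) p}"
    by (intro ecard_mono) auto
  also have "\<dots> \<le> max_encapsulated (Suc d) n"
    using cf by (rule ecard_encapsulated_le)
  finally show "ecard {p. encapsulated d n K p} \<le> max_encapsulated (Suc d) n" .
qed

lemma max_encapsulated_mono:
  assumes "n \<ge> 2" "d \<le> d'"
  shows "max_encapsulated d n \<le> max_encapsulated d' n"
  using assms(2) max_encapsulated_mono_Suc[OF assms(1)] by (rule lift_Suc_mono_le[rotated])

section \<open>The recursive inequalities\<close>

text \<open>The essential points lie in a flat of dimension \<open>card B < d\<close>; monotonicity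
  raises this dimension to \<open>d - 1\<close>.\<close>

lemma max_encapsulated_le_codim_1:
  assumes "d \<ge> 1" "n \<ge> 2"
  shows "max_encapsulated d n \<le> of_nat n * max_encapsulated d (n - 1) + max_encapsulated (d - 1) n"
  unfolding max_encapsulated_def[of d n]
proof (rule SUP_least)
  fix K assume "K \<in> {K. convex_family d n K}"
  then have K: "convex_family d n K" by simp
  let ?E = "essential_points d n K"
  have "ecard ?E \<le> max_encapsulated (d - 1) n"
  proof (cases "?E = {}")
    case True
    then show ?thesis by (simp only: ecard_empty zero_le)
  next
    case False
    show ?thesis
    proof (rule essential_points_flat[OF assms(1) K False])
      fix p0 B
      assume B: "p0 \<in> Rn d" "B \<subseteq> Rn d" "finite B" "independent B" "card B < d"
        "\<And>p. p \<in> ?E \<Longrightarrow> p - p0 \<in> span B"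
      have "ecard ?E \<le> max_encapsulated (card B) n"
        using B by (intro ecard_flat_le[OF K]) (auto simp: essential_points_def)
      also have "\<dots> \<le> max_encapsulated (d - 1) n"
        using assms B(5) by (intro max_encapsulated_mono) auto
      finally show ?thesis .
    qed
  qed
  then show "ecard {p. encapsulated d n K p}
      \<le> of_nat n * max_encapsulated d (n - 1) + max_encapsulated (d - 1) n"
    using ecard_encapsulated_split[OF K] by (meson add_left_mono order_trans)
qed

text \<open>If the essential points span a hyperplane, all encapsulated points lie in it and the
  first recursion applies in dimension \<open>d - 1\<close>. Otherwise
  \<open>card B \<le> d - 2\<close> and the split suffices.\<close>

lemma max_encapsulated_le_codim_2:
  assumes "d \<ge> 2" "n \<ge> 3"
  shows "max_encapsulated d n \<le> of_nat n * max_encapsulated d (n - 1) + max_encapsulated (d - 2) n"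
  unfolding max_encapsulated_def[of d n]
proof (rule SUP_least)
  fix K assume "K \<in> {K. convex_family d n K}"
  then have K: "convex_family d n K" by simp
  let ?A = "{p. encapsulated d n K p}"
  let ?E = "essential_points d n K"
  let ?r = "of_nat n * max_encapsulated d (n - 1) + max_encapsulated (d - 2) n"
  have split: "ecard ?A \<le> ?r" if "ecard ?E \<le> max_encapsulated (d - 2) n"
    using ecard_encapsulated_split[OF K] that by (meson add_left_mono order_trans)
  show "ecard ?A \<le> ?r"
  proof (cases "?E = {}")
    case True
    then show ?thesis by (intro split) (simp only: ecard_empty zero_le)
  next
    case False
    have "d \<ge> 1" using assms by simp
    show ?thesis
    proof (rule essential_points_flat[OF \<open>d \<ge> 1\<close> K False])
      fix p0 B
      assume B: "p0 \<in> Rn d" "B \<subseteq> Rn d" "finite B" "independent B" "card B < d"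
        "\<And>p. p \<in> ?E \<Longrightarrow> p - p0 \<in> span B"
        "\<And>p. card B = d - 1 \<Longrightarrow> encapsulated d n K p \<Longrightarrow> p - p0 \<in> span B"
      show ?thesis
      proof (cases "card B = d - 1")
        case True
        have "ecard ?A \<le> max_encapsulated (card B) n"
          using B(1-4) B(7)[OF True] by (intro ecard_flat_le[OF K]) auto
        also have "\<dots> \<le> of_nat n * max_encapsulated (d - 1) (n - 1) + max_encapsulated (d - 1 - 1) n"
          unfolding True using assms by (intro max_encapsulated_le_codim_1) auto
        \<comment> \<open>Monotonicity is used for \<open>n - 1\<close> sets, which is why
          \<open>n \<ge> 3\<close>.\<close>
        also have "\<dots> \<le> ?r"
          using assms by (intro add_mono mult_left_mono max_encapsulated_mono) auto
        finally show ?thesis .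
      next
        case False
        have "ecard ?E \<le> max_encapsulated (card B) n"
          using B by (intro ecard_flat_le[OF K]) (auto simp: essential_points_def)
        also have "\<dots> \<le> max_encapsulated (d - 2) n"
          using assms B(5) False by (intro max_encapsulated_mono) auto
        finally show ?thesis by (rule split)
      qed
    qed
  qed
qed

subsection \<open>The explicit bound\<close>

lemma max_encapsulated_dim_0: "max_encapsulated 0 n \<le> 1"
  unfolding max_encapsulated_def
proof (rule SUP_least)
  fix K
  have "{p. encapsulated 0 n K p} \<subseteq> {0}"
    by (auto simp: encapsulated_def Rn_iff)
  then have "ecard {p. encapsulated 0 n K p} \<le> ecard {0::nat \<Rightarrow> real}"
    by (rule ecard_mono)
  then show "ecard {p. encapsulated 0 n K p} \<le> 1"
    by (simp add: ecard_def one_enat_def)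
qed

text \<open>An encapsulated \<open>p\<close> would be the midpoint of two nearby points of the set.
  In dimension 0 there are no such points, and the empty set does encapsulate.\<close>

lemma max_encapsulated_one_set:
  assumes "d \<ge> 1"
  shows "max_encapsulated d 1 = 0"
proof -
  have "\<not> encapsulated d 1 K p" if K: "convex_family d 1 K" for K p
  proof
    assume "encapsulated d 1 K p"
    then obtain \<delta> where p: "p \<in> Rn d" "p \<notin> K 1" and "\<delta> > 0"
      and \<delta>: "\<And>x. x \<in> Rn d \<Longrightarrow> x \<noteq> p \<Longrightarrow> (\<And>i. i < d \<Longrightarrow> \<bar>x i - p i\<bar> < \<delta>) \<Longrightarrow> x \<in> K 1"
      by (auto simp: encapsulated_iff punctured_nhd_def)
    define e :: "nat \<Rightarrow> real" where "e j = (if j = 0 then \<delta> / 2 else 0)" for j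
    have e: "e \<in> Rn d" "e \<noteq> 0"
      using assms \<open>\<delta> > 0\<close> by (auto simp: Rn_iff e_def fun_eq_iff)
    have "p + e \<in> K 1"
      using e \<open>\<delta> > 0\<close> p(1) by (intro \<delta> subspace_add[OF subspace_Rn]) (auto simp: e_def)
    moreover have "p - e \<in> K 1"
      using e \<open>\<delta> > 0\<close> p(1) by (intro \<delta> subspace_diff[OF subspace_Rn]) (auto simp: e_def)
    ultimately have "(1/2) *\<^sub>R (p + e) + (1/2) *\<^sub>R (p - e) \<in> K 1"
      using K by (intro convexD) (auto simp: convex_family_def)
    moreover have "(1/2) *\<^sub>R (p + e) + (1/2) *\<^sub>R (p - e) = p"
      by (simp add: fun_eq_iff field_simps)
    ultimately show False
      using p by simp
  qed
  then have "{p. encapsulated d 1 K p} = {}" if "convex_family d 1 K" for K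
    using that by blast
  then have "max_encapsulated d 1 \<le> 0"
    unfolding max_encapsulated_def by (intro SUP_least) (metis ecard_empty mem_Collect_eq order_refl)
  then show ?thesis by simp
qed

text \<open>One set encapsulates nothing when \<open>d \<ge> 1\<close>, so the recursion for
  \<open>n = 2\<close> just descends to dimension 0.\<close>

lemma max_encapsulated_two_sets: "max_encapsulated d 2 \<le> 1"
proof (induction d)
  case 0
  show ?case by (rule max_encapsulated_dim_0)
next
  case (Suc d)
  then show ?case
    using max_encapsulated_le_codim_1[of "Suc d" 2] max_encapsulated_one_set[of "Suc d"] by simp
qed

text \<open>Subtracting 1 leaves room for the single point of dimension 0, to which the bound
  with \<open>d = 0\<close> does not apply.\<close>

lemma max_encapsulated_le:
  assumes "d \<ge> 1"
  shows "max_encapsulated d (k + 2) \<le> enat (2 * d ^ k * fact (k + 2) - 1)"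
  using assms
proof (induction k arbitrary: d)
  case 0
  \<comment> \<open>The claimed bound for two sets is 2 * 2! - 1 = 3.\<close>
  have "(1::enat) \<le> enat 3"
    by (simp add: one_enat_def)
  with max_encapsulated_two_sets[of d] have "max_encapsulated d 2 \<le> enat 3"
    by (rule order_trans)
  then show ?case
    by (simp add: numeral_2_eq_2 numeral_3_eq_3)
next
  case (Suc k)
  define F where "F = (fact (k + 3) :: nat)"
  have F: "F = (k + 3) * fact (k + 2)" "F \<ge> 1"
    using fact_Suc[of "k + 2", where ?'a = nat] fact_ge_1[of "k + 3", where ?'a = nat]
    by (simp_all add: F_def eval_nat_numeral del: fact_Suc)
  \<comment> \<open>The outer induction runs over the number of sets, the inner one over the
    dimension. \<open>c\<close> stands for the bound in dimension \<open>d - 1\<close>.\<close>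
  have step: "max_encapsulated d (k + 3) \<le> enat (2 * d ^ k * F - (k + 3) + c)"
    if "d \<ge> 1" "max_encapsulated (d - 1) (k + 3) \<le> enat c" for d c
  proof -
    have "max_encapsulated d (k + 3)
        \<le> of_nat (k + 3) * max_encapsulated d (k + 2) + max_encapsulated (d - 1) (k + 3)"
      using max_encapsulated_le_codim_1[of d "k + 3"] that by simp
    also have "\<dots> \<le> enat (k + 3) * enat (2 * d ^ k * fact (k + 2) - 1) + enat c"
      unfolding of_nat_eq_enat using Suc.IH[OF that(1)] that(2) by (intro add_mono mult_left_mono) auto
    also have "\<dots> = enat ((k + 3) * (2 * d ^ k * fact (k + 2) - 1) + c)"
      by simp
    also have "(k + 3) * (2 * d ^ k * fact (k + 2) - 1) = 2 * d ^ k * F - (k + 3)"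
      unfolding F by (simp only: diff_mult_distrib2 mult_1_left mult_1_right ac_simps)
    finally show ?thesis .
  qed
  have "max_encapsulated d (k + 3) \<le> enat (2 * d ^ Suc k * F - 1)" if "d \<ge> 1" for d
    using that
  proof (induction d rule: nat_induct_at_least)
    case base
    \<comment> \<open>This keeps the natural subtraction of \<open>k + 3\<close> from truncating.
      With \<open>c = 1\<close> from dimension 0, the claim amounts to
      \<open>k + 3 \<ge> 2\<close>.\<close>
    have "F \<ge> k + 3"
      unfolding F using mult_le_mono2[OF fact_ge_1, of "k + 3" "k + 2"] by (simp only: mult_1_right)
    then have "2 * 1 ^ k * F - (k + 3) + 1 \<le> 2 * 1 ^ Suc k * F - 1"
      by simp
    moreover have "max_encapsulated 1 (k + 3) \<le> enat (2 * 1 ^ k * F - (k + 3) + 1)"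
      using max_encapsulated_dim_0 by (intro step) (simp_all add: one_enat_def)
    ultimately show ?case
      by (meson enat_ord_simps(1) order_trans)
  next
    case (Suc d)
    \<comment> \<open>Needed so that the subtraction of 1 in the inner hypothesis is a true
      one.\<close>
    have pos: "1 \<le> 2 * d ^ Suc k * F"
      using Suc.hyps F(2) by simp
    \<comment> \<open>Splitting \<open>Suc d ^ Suc k\<close> as
      \<open>Suc d ^ k + d * Suc d ^ k\<close> reduces the growth estimate to this.\<close>
    have "d ^ Suc k \<le> d * Suc d ^ k"
      by (simp add: power_mono)
    then have "Suc d ^ k + d ^ Suc k \<le> Suc d ^ Suc k"
      by simp
    then have "2 * (Suc d ^ k + d ^ Suc k) * F \<le> 2 * Suc d ^ Suc k * F"
      by (intro mult_le_mono) auto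
    then have "2 * Suc d ^ k * F + 2 * d ^ Suc k * F \<le> 2 * Suc d ^ Suc k * F"
      by (simp only: distrib_left distrib_right)
    then have "2 * Suc d ^ k * F - (k + 3) + (2 * d ^ Suc k * F - 1) \<le> 2 * Suc d ^ Suc k * F - 1"
      using pos by linarith
    moreover have "max_encapsulated (Suc d) (k + 3)
        \<le> enat (2 * Suc d ^ k * F - (k + 3) + (2 * d ^ Suc k * F - 1))"
      using Suc.IH by (intro step) simp_all
    ultimately show ?case
      by (meson enat_ord_simps(1) order_trans)
  qed
  from this[OF Suc.prems] show ?case
    by (simp only: F_def numeral_3_eq_3 numeral_2_eq_2 add_Suc_right add_Suc)
qed

theorem theorem1p3:
  fixes d n :: nat
  assumes "n > 3" and "d \<ge> 2"
  shows "max_encapsulated d n \<le> (\<Sum>i=2..n-1. of_nat (n choose i) * max_encapsulated d i) + max_encapsulated (d - 2) n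
    \<and> max_encapsulated d n \<le> of_nat (2 * d ^ (n - 2) * fact n)"
proof
  have "of_nat n * max_encapsulated d (n - 1) = of_nat (n choose (n - 1)) * max_encapsulated d (n - 1)"
    using assms binomial_symmetric[of 1 n] by simp
  \<comment> \<open>All summands are nonnegative, and the term \<open>i = n - 1\<close> alone is
    enough.\<close>
  also have "\<dots> \<le> (\<Sum>i=2..n-1. of_nat (n choose i) * max_encapsulated d i)"
    using assms by (intro member_le_sum) auto
  finally show "max_encapsulated d n
      \<le> (\<Sum>i=2..n-1. of_nat (n choose i) * max_encapsulated d i) + max_encapsulated (d - 2) n"
    using max_encapsulated_le_codim_2[of d n] assms by (meson add_right_mono less_imp_le_nat order_trans)
  have "n - 2 + 2 = n"
    using assms by simp
  then have "max_encapsulated d n \<le> enat (2 * d ^ (n - 2) * fact n - 1)"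
    using max_encapsulated_le[of d "n - 2"] assms by simp
  also have "\<dots> \<le> of_nat (2 * d ^ (n - 2) * fact n)"
    unfolding of_nat_eq_enat by simp
  finally show "max_encapsulated d n \<le> of_nat (2 * d ^ (n - 2) * fact n)" .
qed

end
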